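(* Let $q,k_1,\dots,k_q$ be positive integers, and let $\lambda_j,\alpha_i^{(j)}$ ($j=1,\dots,q$; $i=1,\dots,n$) be real constants and $p>0$ a real constant. For $j=1,\dots,q$ let $L_j$ be the differential operator $$L_j=\sum_{i=1}^{n}\left(\frac{r}{x_i}\right)^{p}\left[x_i^{2}\frac{\partial^{2}}{\partial x_i^{2}}+\alpha_i^{(j)}x_i\frac{\partial}{\partial x_i}\right]+\lambda_j,\qquad r^p=x_1^p+\dots+x_n^p,$$ and let $\phi_j$ be defined by $2\phi_j=-p+n(p-1)+\sum_{i=1}^n\alpha_i^{(j)}$. Divide the index set $I=\{1,2,\dots,q\}$ into $$I_1=\{v\in I:\phi_v^2-\lambda_v>0\},\quad I_2=\{v\in I:\phi_v^2-\lambda_v<0\},\quad I_3=\{v\in I:\phi_v^2-\lambda_v=0\}.$$ Then, for arbitrary real constants $A_{v,l},B_{v,l}$ ($v\in I_1$, $0\le l\le k_v-1$), $C_{v,l},D_{v,l}$ ($v\in I_2$, $0\le l\le k_v-1$) and $E_{v,l}$ ($v\in I_3$, $0\le l\le 2k_v-1$), the function $$\begin{aligned}u={}&\sum_{v\in I_1}\sum_{l=0}^{k_v-1}r^{-\phi_v}\left[A_{v,l}\,r^{\sqrt{\phi_v^2-\lambda_v}}+B_{v,l}\,r^{-\sqrt{\phi_v^2-\lambda_v}}\right](\ln r)^l\\&+\sum_{v\in I_2}\sum_{l=0}^{k_v-1}r^{-\phi_v}\left[C_{v,l}\cos\left(\sqrt{\lambda_v-\phi_v^2}\,\ln r\right)+D_{v,l}\sin\left(\sqrt{\lambda_v-\phi_v^2}\,\ln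 r\right)\right](\ln r)^l\\&+\sum_{v\in I_3}\sum_{l=0}^{2k_v-1}E_{v,l}\,r^{-\phi_v}(\ln r)^l\end{aligned}$$ is a (radial, $r^m$ type) solution of the iterated equation $$\left(\prod_{j=1}^{q}L_j^{k_j}\right)u=\left(L_1^{k_1}L_2^{k_2}\cdots L_q^{k_q}\right)u=0.$$
   Context: $x=(x_1,\dots,x_n)$ denotes points of $\mathbb{R}^n$, and $r>0$ is defined by $r^p=x_1^p+\dots+x_n^p$. Functions are real-valued, and everything is considered on an open regularity domain $D\subset\mathbb{R}^n$ on which the coefficients of the operators and the functions involved are defined, real-valued and smooth, with $r>0$ (for instance, the set where all $x_i>0$). $L_j^{k}$ denotes the successive application of $L_j$, i.e. $L_j^{k}u=L_j(L_j^{k-1}u)$, and the product of operators denotes composition. *)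

theory Defs
  imports "HOL-Analysis.Analysis"
begin

text \<open>
  The exponent \<^term>\<open>p\<close> is an arbitrary positive real, so a power of a base of either sign is
  needed. For a negative base the real power exists iff the exponent is a fraction \<open>a / b\<close> with
  \<open>b\<close> odd; it is then \<open>(root b x)\<^sup>a\<close>, i.e. \<open>\<plusminus> \<bar>x\<bar>\<^sup>p\<close> with the sign given by the parity of \<open>a\<close>.
  Outside \<open>real_power_defined\<close> the value of \<open>real_power\<close> is irrelevant.
\<close>

definition real_power_defined :: "real \<Rightarrow> real \<Rightarrow> bool" where
  "real_power_defined x p \<longleftrightarrow>
     0 < x \<or> (x < 0 \<and> (\<exists>a b :: int. odd b \<and> p = of_int a / of_int b))"

definition real_power :: "real \<Rightarrow> real \<Rightarrow> real" where
  "real_power x p =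
     (if x < 0 \<and> (\<exists>a b :: int. odd a \<and> odd b \<and> p = of_int a / of_int b)
      then - (\<bar>x\<bar> powr p) else \<bar>x\<bar> powr p)"

lemma real_power_pos: "0 < x \<Longrightarrow> real_power x p = x powr p"
  by (simp add: real_power_def)

lemma odd_fraction_unique:
  fixes a b c d :: int
  assumes "odd b" "odd d" "real_of_int a / of_int b = of_int c / of_int d"
  shows "odd a \<longleftrightarrow> odd c"
proof -
  have "b \<noteq> 0" "d \<noteq> 0" using assms by auto
  then have "real_of_int (a * d) = of_int (c * b)"
    using assms(3) by (simp add: field_simps)
  then have "a * d = c * b" by linarith
  then show ?thesis using assms(1,2) by (metis even_mult_iff)
qed

lemma real_power_root:
  fixes a :: int and b :: nat
  assumes "odd b" "x \<noteq> 0"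
  shows "real_power x (of_int a / of_nat b) = root b x powi a"
proof -
  have b: "0 < b" using assms(1) by (simp add: odd_pos)
  have ex: "(\<exists>c d :: int. odd c \<and> odd d \<and> real_of_int a / of_nat b = of_int c / of_int d)
      \<longleftrightarrow> odd a"
    using odd_fraction_unique[of "int b" _ a] assms(1)
    by (metis even_of_nat of_int_of_nat_eq)
  have pos: "root b y powi a = y powr (of_int a / of_nat b)" if "0 < y" for y
  proof -
    have "root b y = y powr (1 / of_nat b)"
      using that b by (simp add: root_powr_inverse)
    moreover have "root b y powi a = root b y powr of_int a"
      using that b by (simp add: powr_real_of_int')
    ultimately show ?thesis by (simp add: powr_powr)
  qed
  show ?thesis
  proof (cases "0 < x")
    case True
    then show ?thesis using pos by (simp add: real_power_pos)
  next
    case False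
    then have x: "x < 0" using assms(2) by simp
    have "root b x = - root b (- x)" using real_root_minus[of b "- x"] by simp
    then have "root b x powi a = (if odd a then - (root b (- x) powi a) else root b (- x) powi a)"
      by (simp add: power_int_minus_left)
    then show ?thesis using x ex pos[of "- x"] by (auto simp: real_power_def)
  qed
qed

lemma real_power_of_int: "x \<noteq> 0 \<Longrightarrow> real_power x (of_int a) = x powi a"
  using real_power_root[of 1 x a] by simp

definition rad :: "real \<Rightarrow> real ^ 'n \<Rightarrow> real" where
  "rad p x = (\<Sum>i\<in>UNIV. real_power (x $ i) p) powr (1 / p)"

definition regularity_domain :: "real \<Rightarrow> (real ^ 'n) set \<Rightarrow> bool" where
  "regularity_domain p D \<longleftrightarrow>
     open D \<and>
     (\<forall>x\<in>D. (\<forall>i. real_power_defined (x $ i) p) \<and> 0 < (\<Sum>i\<in>UNIV. real_power (x $ i) p))"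

lemma rad_pos:
  assumes "regularity_domain p D" "x \<in> D"
  shows "0 < rad p x"
  using assms by (auto simp: regularity_domain_def rad_def)

lemma rad_power:
  assumes "regularity_domain p D" "x \<in> D" "0 < p"
  shows "rad p x powr p = (\<Sum>i\<in>UNIV. real_power (x $ i) p)"
  using assms by (auto simp: regularity_domain_def rad_def powr_powr)

lemma regularity_domain_positive_orthant:
  "regularity_domain p {x :: real ^ 'n. \<forall>i. 0 < x $ i}"
proof -
  have "open {x :: real ^ 'n. \<forall>i. 0 < x $ i}"
    unfolding Collect_all_eq by (intro open_INT ballI open_Collect_less continuous_intros) simp
  then show ?thesis
    by (auto simp: regularity_domain_def real_power_defined_def real_power_pos less_imp_neq[THEN not_sym] intro!: sum_pos)
qed

definition partial_deriv :: "'n \<Rightarrow> (real ^ 'n \<Rightarrow> real) \<Rightarrow> real ^ 'n \<Rightarrow> real" where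
  "partial_deriv i u x = deriv (\<lambda>t. u (x + t *\<^sub>R axis i 1)) 0"

lemma partial_deriv_eq:
  assumes "(u has_derivative u') (at x)"
  shows "partial_deriv i u x = u' (axis i 1)"
proof -
  have "((\<lambda>t. x + t *\<^sub>R axis i 1) has_derivative (\<lambda>t. t *\<^sub>R axis i 1)) (at 0)"
    by (auto intro!: derivative_eq_intros)
  then have "((\<lambda>t. u (x + t *\<^sub>R axis i 1)) has_derivative (\<lambda>t. u' (t *\<^sub>R axis i 1))) (at 0)"
    using has_derivative_compose[of "\<lambda>t. x + t *\<^sub>R axis i 1" _ 0 UNIV u u'] assms by simp
  moreover have "(\<lambda>t. u' (t *\<^sub>R axis i 1)) = (*) (u' (axis i 1))"
    using has_derivative_linear[OF assms] by (simp add: linear_cmul fun_eq_iff)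
  ultimately show ?thesis
    by (simp add: partial_deriv_def has_field_derivative_def DERIV_imp_deriv)
qed

text \<open>
  \<open>C_on m D u\<close> is meant for open \<open>D\<close>. Smoothness is required of solutions because \<^const>\<open>deriv\<close> is
  total: it guarantees that all derivatives occurring in the equation are genuine ones.
\<close>

fun C_on :: "nat \<Rightarrow> (real ^ 'n) set \<Rightarrow> (real ^ 'n \<Rightarrow> real) \<Rightarrow> bool" where
  "C_on 0 D u \<longleftrightarrow> continuous_on D u"
| "C_on (Suc m) D u \<longleftrightarrow> u differentiable_on D \<and> (\<forall>i. C_on m D (partial_deriv i u))"

definition smooth_on :: "(real ^ 'n) set \<Rightarrow> (real ^ 'n \<Rightarrow> real) \<Rightarrow> bool" where
  "smooth_on D u \<longleftrightarrow> (\<forall>m. C_on m D u)"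

definition L_op ::
    "real \<Rightarrow> ('n \<Rightarrow> real) \<Rightarrow> real \<Rightarrow> (real ^ 'n \<Rightarrow> real) \<Rightarrow> real ^ 'n \<Rightarrow> real" where
  "L_op p \<alpha> c u x =
     (\<Sum>i\<in>UNIV. real_power (rad p x / x $ i) p *
        ((x $ i)\<^sup>2 * partial_deriv i (partial_deriv i u) x + \<alpha> i * x $ i * partial_deriv i u x))
     + c * u x"

definition iterated_product :: "nat \<Rightarrow> (nat \<Rightarrow> 'f \<Rightarrow> 'f) \<Rightarrow> (nat \<Rightarrow> nat) \<Rightarrow> 'f \<Rightarrow> 'f" where
  "iterated_product q L k = foldr (\<circ>) (map (\<lambda>j. L j ^^ k j) [1..<Suc q]) id"

end

theory Submission
  imports Defs "HOL-Computational_Algebra.Polynomial"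
begin

text \<open>
  On radial functions \<open>u = g (ln r)\<close> the operator \<open>L\<^sub>j\<close> acts as the constant coefficient operator
  \<open>g'' + 2 \<phi>\<^sub>j g' + \<lambda>\<^sub>j g\<close>. Constant coefficient operators commute, so it suffices that each summand
  \<open>s\<^sup>l Re (c exp (z s))\<close> of \<open>g\<close> is annihilated by one factor \<open>(D\<^sup>2 + 2 \<phi>\<^sub>v D + \<lambda>\<^sub>v)\<^sup>k\<close>, where \<open>z\<close> is a
  (possibly double) root of the characteristic polynomial. A function \<open>g\<close> is represented by the
  sequence of its derivatives, on which \<open>D\<close> is the shift.
\<close>

section \<open>Polynomials in the shift operator\<close>

text \<open>This is the polynomial Q in the shift, applied to a sequence. When \<open>f n\<close> is
  the n-th derivative of g at a point, entry n of the result is the n-th derivative of Q(D) g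
  there.\<close>

definition shift_poly :: "'a::idom poly \<Rightarrow> (nat \<Rightarrow> 'a) \<Rightarrow> nat \<Rightarrow> 'a" where
  "shift_poly Q f n = (\<Sum>i\<le>degree Q. coeff Q i * f (n + i))"

lemma shift_poly_0 [simp]: "shift_poly 0 f = (\<lambda>n. 0)"
  by (simp add: shift_poly_def fun_eq_iff)

text \<open>Horner's scheme for a + X Q, the recursion behind the inductions on polynomials.
  \<open>Q = 0\<close> is separate because prepending a coefficient does not raise the degree
  then.\<close>

lemma shift_poly_pCons [simp]:
  "shift_poly (pCons a Q) f = (\<lambda>n. a * f n + shift_poly Q f (Suc n))"
  by (cases "Q = 0") (auto simp: shift_poly_def sum.atMost_Suc_shift fun_eq_iff simp del: sum.atMost_Suc)

lemma shift_poly_add: "shift_poly (P + Q) f n = shift_poly P f n + shift_poly Q f n"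
  by (induction P Q arbitrary: n rule: poly_induct2) (auto simp: algebra_simps)

lemma shift_poly_smult: "shift_poly (smult c Q) f n = c * shift_poly Q f n"
  by (induction Q arbitrary: n) (auto simp: algebra_simps)

text \<open>Products of polynomials become compositions of operators, so commutativity of polynomial
  multiplication lets any factor act first.\<close>

lemma shift_poly_mult: "shift_poly (P * Q) f = shift_poly P (shift_poly Q f)"
  by (induction P) (auto simp: shift_poly_add shift_poly_smult)

lemma shift_poly_zero_fun [simp]: "shift_poly Q (\<lambda>n. 0) = (\<lambda>n. 0)"
  by (simp add: shift_poly_def fun_eq_iff)

lemma shift_poly_add_fun:
  "shift_poly Q (\<lambda>n. f n + g n) n = shift_poly Q f n + shift_poly Q g n"
  by (simp add: shift_poly_def sum.distrib algebra_simps)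

text \<open>
  If \<open>f n\<close> is the \<open>n\<close>-th derivative of \<open>g\<close> at \<open>s\<close>, then \<open>times_var s f n\<close> is that of
  \<open>\<lambda>s. s * g s\<close>; at \<open>n = 0\<close> the junk index \<open>n - 1\<close> is harmless.
\<close>

definition times_var :: "'a::idom \<Rightarrow> (nat \<Rightarrow> 'a) \<Rightarrow> nat \<Rightarrow> 'a" where
  "times_var s f n = s * f n + of_nat n * f (n - 1)"

text \<open>On derivative sequences this is the commutator relation [Q(D), s] = Q'(D). The induction
  step rests on (a + X Q)' = Q + X Q'.\<close>

lemma shift_poly_times_var:
  "shift_poly Q (times_var s f) n = times_var s (shift_poly Q f) n + shift_poly (pderiv Q) f n"
proof (induction Q arbitrary: n)
  case 0
  then show ?case by (simp add: times_var_def)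
next
  case (pCons a Q)
  then show ?case
    by (cases n) (auto simp: times_var_def pderiv_pCons shift_poly_add algebra_simps)
qed

text \<open>Each factor s costs one factor Q: Q^m (s h) = s Q^m h + m Q' Q^(m-1) h. With h = s^l f
  both terms vanish by the induction hypothesis, used for the exponents m and m - 1.\<close>

lemma shift_poly_power_times_var:
  assumes "shift_poly Q f = (\<lambda>n. 0)" "l < m"
  shows "shift_poly (Q ^ m) ((times_var s ^^ l) f) = (\<lambda>n. 0)"
  using assms(2)
proof (induction l arbitrary: m)
  case 0
  then obtain m' where "m = Suc m'" using gr0_conv_Suc by auto
  then have "Q ^ m = Q ^ m' * Q" by (simp add: mult.commute)
  then show ?case using assms(1) by (auto simp: shift_poly_mult)
next
  case (Suc l)
  then obtain m' where m: "m = Suc m'" "l < m'" by (metis Suc_lessE)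
  let ?f = "(times_var s ^^ l) f"
  have "pderiv (Q ^ m) = smult (of_nat m) (pderiv Q) * Q ^ m'"
    unfolding m pderiv_power_Suc by (simp add: mult.commute)
  then have "shift_poly (pderiv (Q ^ m)) ?f = (\<lambda>n. 0)"
    using Suc.IH[OF m(2)] by (auto simp: shift_poly_mult shift_poly_smult simp del: of_nat_Suc)
  moreover have "shift_poly (Q ^ m) ?f = (\<lambda>n. 0)"
    using Suc.IH[of m] m by simp
  ultimately have "shift_poly (Q ^ m) (times_var s ?f) n = 0" for n
    by (simp add: shift_poly_times_var) (simp add: times_var_def)
  then show ?case by auto
qed

lemma times_var_funpow_0: "(times_var s ^^ l) f 0 = s ^ l * f 0"
  by (induction l) (auto simp: times_var_def)

section \<open>Sequences of successive derivatives\<close>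

text \<open>The derivatives are given as data instead of being produced by iterating
  \<open>deriv\<close>. Differentiability is thus built in, and differential equations become
  pointwise identities between sequences.\<close>

definition deriv_seq :: "(nat \<Rightarrow> real \<Rightarrow> real) \<Rightarrow> bool" where
  "deriv_seq F \<longleftrightarrow> (\<forall>n s. (F n has_real_derivative F (Suc n) s) (at s))"

text \<open>Constant coefficients commute with differentiation. This allows the action of one
  operator on a radial function to be fed into the next.\<close>

lemma deriv_seq_shift_poly:
  assumes "deriv_seq F"
  shows "deriv_seq (\<lambda>n s. shift_poly Q (\<lambda>m. F m s) n)"
  using assms unfolding deriv_seq_def shift_poly_def
  by (auto intro!: derivative_eq_intros sum.cong)

lemma deriv_seq_times_var:
  assumes "deriv_seq F"
  shows "deriv_seq (\<lambda>n s. times_var s (\<lambda>m. F m s) n)"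
  unfolding deriv_seq_def
proof (intro allI)
  fix n s
  have D: "(F m has_real_derivative F (Suc m) s) (at s)" for m
    using assms by (simp add: deriv_seq_def)
  show "((\<lambda>s. times_var s (\<lambda>m. F m s) n) has_real_derivative
      times_var s (\<lambda>m. F m s) (Suc n)) (at s)"
    unfolding times_var_def
    \<comment> \<open>For n = 0 the second summand is zero; otherwise \<open>F (n - 1)\<close> has
      the derivative \<open>F n\<close>.\<close>
    by (cases n) (auto intro!: derivative_eq_intros D simp: algebra_simps)
qed

lemma deriv_seq_times_var_funpow:
  assumes "deriv_seq F"
  shows "deriv_seq (\<lambda>n s. (times_var s ^^ l) (\<lambda>m. F m s) n)"
proof (induction l)
  case 0
  then show ?case using assms by simp
next
  case (Suc l)
  then show ?case using deriv_seq_times_var[OF Suc] by simp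
qed

text \<open>The exponential is differentiated as a holomorphic function, restricted to the real line
  and composed with the bounded linear map \<open>Re\<close>. One complex family covers
  exponentials, cosines and sines.\<close>

lemma deriv_seq_Re_exp:
  "deriv_seq (\<lambda>n s. Re (c * z ^ n * exp (z * of_real s)))"
  unfolding deriv_seq_def
proof (intro allI)
  fix n :: nat and s :: real
  have "((\<lambda>w. c * z ^ n * exp (z * w)) has_field_derivative c * z ^ Suc n * exp (z * of_real s))
      (at (of_real s))"
    by (auto intro!: derivative_eq_intros)
  then have "((\<lambda>t. c * z ^ n * exp (z * of_real t)) has_vector_derivative
      c * z ^ Suc n * exp (z * of_real s)) (at s)"
    by (rule has_vector_derivative_real_field)
  from bounded_linear.has_vector_derivative[OF bounded_linear_Re this]
  show "((\<lambda>s. Re (c * z ^ n * exp (z * of_real s))) has_real_derivative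
      Re (c * z ^ Suc n * exp (z * of_real s))) (at s)"
    by (simp add: has_real_derivative_iff_has_vector_derivative)
qed

text \<open>This encodes Q(D) g = 0. Vanishing at all indices is an equality of sequences, which any
  further polynomial in the shift maps to zero again.\<close>

definition solves_ode :: "real poly \<Rightarrow> (real \<Rightarrow> real) \<Rightarrow> bool" where
  "solves_ode Q g \<longleftrightarrow>
     (\<exists>F. deriv_seq F \<and> F 0 = g \<and> (\<forall>s. shift_poly Q (\<lambda>n. F n s) = (\<lambda>n. 0)))"

lemma solves_ode_0: "solves_ode Q (\<lambda>s. 0)"
  unfolding solves_ode_def by (rule exI[of _ "\<lambda>n s. 0"]) (auto simp: deriv_seq_def)

lemma solves_ode_add:
  assumes "solves_ode Q f" "solves_ode Q g"
  shows "solves_ode Q (\<lambda>s. f s + g s)"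
proof -
  obtain F G where
    F: "deriv_seq F" "F 0 = f" "\<And>s. shift_poly Q (\<lambda>n. F n s) = (\<lambda>n. 0)" and
    G: "deriv_seq G" "G 0 = g" "\<And>s. shift_poly Q (\<lambda>n. G n s) = (\<lambda>n. 0)"
    using assms unfolding solves_ode_def by metis
  have "deriv_seq (\<lambda>n s. F n s + G n s)"
    using F(1) G(1) by (auto simp: deriv_seq_def intro!: DERIV_add)
  moreover have "shift_poly Q (\<lambda>n. F n s + G n s) = (\<lambda>n. 0)" for s
    by (simp add: fun_eq_iff shift_poly_add_fun F(3) G(3))
  ultimately show ?thesis unfolding solves_ode_def
    using F(2) G(2) by (intro exI[of _ "\<lambda>n s. F n s + G n s"]) auto
qed

lemma solves_ode_sum:
  "(\<And>i. i \<in> I \<Longrightarrow> solves_ode Q (f i)) \<Longrightarrow> solves_ode Q (\<lambda>s. \<Sum>i\<in>I. f i s)"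
  by (induction I rule: infinite_finite_induct) (auto intro: solves_ode_0 solves_ode_add)

lemma solves_ode_dvd:
  assumes "solves_ode Q g" "Q dvd R"
  shows "solves_ode R g"
proof -
  obtain S where "R = S * Q" using assms(2) by (metis dvdE mult.commute)
  then have "shift_poly R f = (\<lambda>n. 0)" if "shift_poly Q f = (\<lambda>n. 0)" for f
    using that by (auto simp: shift_poly_mult)
  then show ?thesis using assms(1) unfolding solves_ode_def by blast
qed

text \<open>The function exp (z s) is an eigenfunction of Q(D) with eigenvalue Q(z) = 0. Since Q is
  real, Q(D) commutes with \<open>Re\<close>; the factor s^l is paid for by the power
  \<open>Q ^ m\<close>.\<close>

lemma solves_ode_Re_exp:
  assumes "poly (map_poly of_real Q) z = 0" "l < m"
  shows "solves_ode (Q ^ m) (\<lambda>s. s ^ l * Re (c * exp (z * of_real s)))"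
proof -
  let ?F = "\<lambda>n s. Re (c * z ^ n * exp (z * of_real s))"
  have "shift_poly Q (\<lambda>n. ?F n s) n = 0" for n s
  proof -
    \<comment> \<open>The constant \<open>w\<close> absorbs c exp (z s), so that the induction on Q
      only sees a geometric sequence.\<close>
    have "shift_poly Q (\<lambda>n. Re (w * z ^ n)) n = Re (w * z ^ n * poly (map_poly of_real Q) z)" for w
    proof (induction Q arbitrary: n)
      case 0
      then show ?case by simp
    next
      case (pCons a Q)
      have "w * z ^ n * poly (map_poly of_real (pCons a Q)) z =
          a *\<^sub>R (w * z ^ n) + w * z ^ Suc n * poly (map_poly of_real Q) z"
        by (simp add: map_poly_pCons scaleR_conv_of_real algebra_simps)
      then show ?case
        by (simp only: shift_poly_pCons pCons.IH plus_complex.sel scaleR_complex.sel)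
    qed
    from this[of "c * exp (z * of_real s)"] show ?thesis
      using assms(1) by (simp add: mult_ac)
  qed
  then have "shift_poly (Q ^ m) ((times_var s ^^ l) (\<lambda>n. ?F n s)) = (\<lambda>n. 0)" for s
    using assms(2) by (intro shift_poly_power_times_var) auto
  then show ?thesis unfolding solves_ode_def
    using deriv_seq_times_var_funpow[OF deriv_seq_Re_exp]
    by (intro exI[of _ "\<lambda>n s. (times_var s ^^ l) (\<lambda>n. ?F n s) n"])
      (auto simp: times_var_funpow_0)
qed

section \<open>Algebras of functions closed under partial derivatives\<close>

text \<open>Smoothness of a composite expression is reduced to its generators. The rule
  \<open>cong\<close> ignores values outside D, because partial derivatives are computed only on
  D.\<close>

inductive_set function_algebra ::
    "'a set \<Rightarrow> ('a \<Rightarrow> real) set \<Rightarrow> ('a \<Rightarrow> real) set" for D G where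
  gen: "g \<in> G \<Longrightarrow> g \<in> function_algebra D G"
| const: "(\<lambda>x. c) \<in> function_algebra D G"
| add: "f \<in> function_algebra D G \<Longrightarrow> g \<in> function_algebra D G \<Longrightarrow>
    (\<lambda>x. f x + g x) \<in> function_algebra D G"
| mult: "f \<in> function_algebra D G \<Longrightarrow> g \<in> function_algebra D G \<Longrightarrow>
    (\<lambda>x. f x * g x) \<in> function_algebra D G"
| cong: "f \<in> function_algebra D G \<Longrightarrow> (\<And>x. x \<in> D \<Longrightarrow> g x = f x) \<Longrightarrow>
    g \<in> function_algebra D G"

lemma differentiable_on_open_has_derivative:
  assumes "f differentiable_on D" "open D" "x \<in> D"
  shows "\<exists>f'. (f has_derivative f') (at x)"
  using assms by (auto simp: differentiable_on_eq_differentiable_at differentiable_def)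

lemma has_derivative_imp_differentiable_on:
  assumes "\<And>x. x \<in> D \<Longrightarrow> (f has_derivative f' x) (at x)"
  shows "f differentiable_on D"
  using assms by (meson differentiable_at_withinI differentiable_def differentiable_on_def)

lemma partial_deriv_eq_on_open:
  assumes "open D" "x \<in> D" "\<And>y. y \<in> D \<Longrightarrow> u y = v y" "(v has_derivative v') (at x)"
  shows "partial_deriv i u x = v' (axis i 1)"
proof -
  have "(u has_derivative v') (at x)"
    using has_derivative_transform_within_open[OF assms(4,1,2)] assms(3) by simp
  then show ?thesis by (rule partial_deriv_eq)
qed

text \<open>By the sum and product rules, it is enough that the partial derivatives of the
  generators stay in the algebra.\<close>

lemma function_algebra_partial_deriv:
  fixes D :: "(real ^ 'n::finite) set"
  assumes "open D"
    and G: "\<And>g. g \<in> G \<Longrightarrow> g differentiable_on D"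
      "\<And>g i. g \<in> G \<Longrightarrow> partial_deriv i g \<in> function_algebra D G"
    and "f \<in> function_algebra D G"
  shows "f differentiable_on D \<and> (\<forall>i. partial_deriv i f \<in> function_algebra D G)"
  using assms(4)
proof induction
  case (gen g)
  then show ?case using G by blast
next
  case (const c)
  have "partial_deriv i (\<lambda>x. c) = (\<lambda>x. 0)" for i :: 'n
    using partial_deriv_eq[OF has_derivative_const] by blast
  then show ?case by (auto intro: function_algebra.const)
next
  case (add f g)
  have "partial_deriv i (\<lambda>x. f x + g x) x = partial_deriv i f x + partial_deriv i g x"
    if "x \<in> D" for i x
  proof -
    obtain f' g' where "(f has_derivative f') (at x)" "(g has_derivative g') (at x)"
      using differentiable_on_open_has_derivative[OF _ assms(1) \<open>x \<in> D\<close>] add.IH by blast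
    then show ?thesis
      using partial_deriv_eq[OF has_derivative_add] by (simp add: partial_deriv_eq)
  qed
  moreover have "(\<lambda>x. partial_deriv i f x + partial_deriv i g x) \<in> function_algebra D G" for i
    using add by (intro function_algebra.add) auto
  ultimately show ?case using add.IH
    by (auto intro!: differentiable_on_add intro: function_algebra.cong)
next
  case (mult f g)
  have "partial_deriv i (\<lambda>x. f x * g x) x = f x * partial_deriv i g x + partial_deriv i f x * g x"
    if "x \<in> D" for i x
  proof -
    obtain f' g' where "(f has_derivative f') (at x)" "(g has_derivative g') (at x)"
      using differentiable_on_open_has_derivative[OF _ assms(1) \<open>x \<in> D\<close>] mult.IH by blast
    then show ?thesis
      using partial_deriv_eq[OF has_derivative_mult] by (simp add: partial_deriv_eq)
  qed
  moreover have "(\<lambda>x. f x * partial_deriv i g x + partial_deriv i f x * g x) \<in> function_algebra D G"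
    for i
    using mult by (intro function_algebra.add function_algebra.mult) auto
  ultimately show ?case using mult.IH
    by (auto intro!: differentiable_on_mult intro: function_algebra.cong)
next
  case (cong f g)
  have "partial_deriv i g x = partial_deriv i f x" if "x \<in> D" for i x
  proof -
    obtain f' where "(f has_derivative f') (at x)"
      using differentiable_on_open_has_derivative[OF _ assms(1) \<open>x \<in> D\<close>] cong.IH by blast
    then show ?thesis
      using partial_deriv_eq_on_open[OF assms(1) that] cong.hyps(2) by (simp add: partial_deriv_eq)
  qed
  moreover have "g differentiable_on D"
    using cong.IH cong.hyps(2) unfolding differentiable_on_def
    by (metis differentiable_transform_within zero_less_one)
  ultimately show ?case using cong.IH by (auto intro: function_algebra.cong)
qed

text \<open>Each level of \<open>C_on\<close> passes from f to its partial derivatives, which are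
  again members; hence the induction is over all members at once.\<close>

lemma function_algebra_smooth_on:
  fixes D :: "(real ^ 'n::finite) set"
  assumes "open D"
    and "\<And>g. g \<in> G \<Longrightarrow> g differentiable_on D"
      "\<And>g i. g \<in> G \<Longrightarrow> partial_deriv i g \<in> function_algebra D G"
    and "f \<in> function_algebra D G"
  shows "smooth_on D f"
proof -
  note * = function_algebra_partial_deriv[OF assms(1-3)]
  have "C_on m D f" for m
    using assms(4)
    by (induction m arbitrary: f) (use * in \<open>auto intro: differentiable_imp_continuous_on\<close>)
  then show ?thesis by (simp add: smooth_on_def)
qed

section \<open>Derivatives of radial functions\<close>

lemma real_power_alt:
  obtains \<sigma> where "\<And>x. x < 0 \<Longrightarrow> real_power x p = \<sigma> * \<bar>x\<bar> powr p" "\<sigma> * \<sigma> = (1::real)"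
  by (rule that[of "if \<exists>a b :: int. odd a \<and> odd b \<and> p = of_int a / of_int b then -1 else 1"])
    (auto simp: real_power_def)

lemma real_power_nonzero: "x \<noteq> 0 \<Longrightarrow> real_power x p \<noteq> 0"
  by (simp add: real_power_def)

lemma real_power_divide:
  assumes "0 < r" "x \<noteq> 0"
  shows "real_power (r / x) p = r powr p / real_power x p"
proof (cases "0 < x")
  case True
  then show ?thesis using assms by (simp add: real_power_pos powr_divide)
next
  case False
  then have "x < 0" "r / x < 0" using assms by (auto simp: divide_less_0_iff)
  obtain \<sigma> where \<sigma>: "\<And>x. x < 0 \<Longrightarrow> real_power x p = \<sigma> * \<bar>x\<bar> powr p" "\<sigma> * \<sigma> = 1"
    using real_power_alt by blast
  \<comment> \<open>The sign stands in the numerator on one side of the claim and in the denominator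
    on the other.\<close>
  have "\<sigma> = 1 / \<sigma>" using \<sigma>(2) by (metis mult_zero_left nonzero_eq_divide_eq zero_neq_one)
  then show ?thesis
    using \<sigma>(1)[OF \<open>x < 0\<close>] \<sigma>(1)[OF \<open>r / x < 0\<close>] assms
    by (metis abs_divide abs_ge_zero abs_of_pos powr_divide mult_1 times_divide_times_eq)
qed

lemma has_real_derivative_real_power:
  assumes "x \<noteq> 0"
  shows "((\<lambda>x. real_power x p) has_real_derivative p * real_power x p / x) (at x)"
proof (cases "0 < x")
  case True
  have "((\<lambda>x. x powr p) has_real_derivative p * x powr p / x) (at x)"
    using True by (auto intro!: derivative_eq_intros simp: powr_diff)
  then show ?thesis
    by (rule has_field_derivative_transform_within_open[of _ _ _ "{0<..}", THEN DERIV_cong])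
      (use True in \<open>auto simp: real_power_pos\<close>)
next
  case False
  then have x: "x < 0" using assms by simp
  obtain \<sigma> where \<sigma>: "\<And>x. x < 0 \<Longrightarrow> real_power x p = \<sigma> * \<bar>x\<bar> powr p"
    using real_power_alt by blast
  have "((\<lambda>x. \<sigma> * (- x) powr p) has_real_derivative p * (\<sigma> * (- x) powr p) / x) (at x)"
    using x by (auto intro!: derivative_eq_intros simp: powr_diff)
  then show ?thesis
    by (rule has_field_derivative_transform_within_open[of _ _ _ "{..<0}", THEN DERIV_cong])
      (use x in \<open>auto simp: \<sigma>\<close>)
qed

text \<open>On a regularity domain this is r^p. As ln r is its logarithm divided by p, derivatives
  of r itself are avoided.\<close>

definition power_sum :: "real \<Rightarrow> real ^ 'n \<Rightarrow> real" where
  "power_sum p x = (\<Sum>i\<in>UNIV. real_power (x $ i) p)"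

section \<open>Differential calculus on a regularity domain\<close>

context
  fixes p :: real and \<Omega> :: "(real ^ 'n::finite) set"
  assumes p: "0 < p" and dom: "regularity_domain p \<Omega>"
begin

lemma open_dom: "open \<Omega>"
  using dom by (simp add: regularity_domain_def)

lemma nonzero_dom: "x \<in> \<Omega> \<Longrightarrow> x $ i \<noteq> 0"
  using dom unfolding regularity_domain_def real_power_defined_def by (metis less_irrefl)

lemma power_sum_pos: "x \<in> \<Omega> \<Longrightarrow> 0 < power_sum p x"
  using dom by (simp add: regularity_domain_def power_sum_def)

lemma ln_rad: "x \<in> \<Omega> \<Longrightarrow> ln (rad p x) = ln (power_sum p x) / p"
  using power_sum_pos by (auto simp: rad_def power_sum_def[symmetric] ln_powr)

lemma has_derivative_coord_power:
  assumes "x \<in> \<Omega>"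
  shows "((\<lambda>x. real_power (x $ i) p) has_derivative
    (\<lambda>h. p * real_power (x $ i) p / x $ i * h $ i)) (at x)"
proof -
  have "((\<lambda>t. real_power t p) has_derivative (*) (p * real_power (x $ i) p / x $ i)) (at (x $ i))"
    using has_real_derivative_real_power[OF nonzero_dom[OF assms]]
    by (simp add: has_field_derivative_def)
  from has_derivative_compose[OF bounded_linear_imp_has_derivative[OF bounded_linear_vec_nth] this]
  show ?thesis by simp
qed

lemma has_derivative_power_sum:
  assumes "x \<in> \<Omega>"
  shows "(power_sum p has_derivative
    (\<lambda>h. \<Sum>i\<in>UNIV. p * real_power (x $ i) p / x $ i * h $ i)) (at x)"
  unfolding power_sum_def[abs_def]
  by (intro has_derivative_sum has_derivative_coord_power assms)

lemma has_derivative_inverse_coord: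
  assumes "x \<in> \<Omega>"
  shows "((\<lambda>x. inverse (x $ i)) has_derivative (\<lambda>h. - (inverse (x $ i))\<^sup>2 * h $ i)) (at x)"
proof -
  have "((\<lambda>x. x $ i) has_derivative (\<lambda>h. h $ i)) (at x)"
    by (rule bounded_linear_imp_has_derivative[OF bounded_linear_vec_nth])
  from Deriv.has_derivative_inverse[OF nonzero_dom[OF assms] this]
  show ?thesis by (simp add: power2_eq_square mult_ac)
qed

lemma has_derivative_inverse_power_sum:
  assumes "x \<in> \<Omega>"
  shows "((\<lambda>x. inverse (power_sum p x)) has_derivative
    (\<lambda>h. - (inverse (power_sum p x))\<^sup>2 * (\<Sum>i\<in>UNIV. p * real_power (x $ i) p / x $ i * h $ i))) (at x)"
proof -
  have "power_sum p x \<noteq> 0" using power_sum_pos[OF assms] by simp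
  from Deriv.has_derivative_inverse[OF this has_derivative_power_sum[OF assms]]
  show ?thesis by (simp add: power2_eq_square mult_ac)
qed

text \<open>Chain rule with the partial derivatives x_i^(p-1) / r^p of ln r; the factor p from x_i^p
  cancels against ln r = ln (r^p) / p.\<close>

lemma has_derivative_radial:
  assumes "deriv_seq F" "x \<in> \<Omega>"
  shows "((\<lambda>x. F n (ln (rad p x))) has_derivative
    (\<lambda>h. F (Suc n) (ln (rad p x)) *
      ((\<Sum>i\<in>UNIV. real_power (x $ i) p / x $ i * h $ i) * inverse (power_sum p x)))) (at x)"
proof -
  have "((\<lambda>x. ln (power_sum p x)) has_derivative
     (\<lambda>h. (\<Sum>i\<in>UNIV. p * real_power (x $ i) p / x $ i * h $ i) * inverse (power_sum p x))) (at x)"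
    by (rule has_derivative_ln[OF power_sum_pos[OF assms(2)] has_derivative_power_sum[OF assms(2)]])
  moreover have "(\<Sum>i\<in>UNIV. p * real_power (x $ i) p / x $ i * h $ i) =
      p * (\<Sum>i\<in>UNIV. real_power (x $ i) p / x $ i * h $ i)" for h :: "real ^ 'n"
    by (simp add: sum_distrib_left mult_ac)
  ultimately have "((\<lambda>x. ln (power_sum p x)) has_derivative
     (\<lambda>h. p * (\<Sum>i\<in>UNIV. real_power (x $ i) p / x $ i * h $ i) * inverse (power_sum p x))) (at x)"
    by (simp only:)
  from bounded_linear.has_derivative[OF bounded_linear_divide[of p] this]
  have "((\<lambda>x. ln (power_sum p x) / p) has_derivative
     (\<lambda>h. (\<Sum>i\<in>UNIV. real_power (x $ i) p / x $ i * h $ i) * inverse (power_sum p x))) (at x)"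
    using p by simp
  then have s: "((\<lambda>x. ln (rad p x)) has_derivative
     (\<lambda>h. (\<Sum>i\<in>UNIV. real_power (x $ i) p / x $ i * h $ i) * inverse (power_sum p x))) (at x)"
    by (rule has_derivative_transform_within_open[OF _ open_dom assms(2)]) (simp add: ln_rad)
  have "(F n has_derivative (*) (F (Suc n) (ln (rad p x)))) (at (ln (rad p x)))"
    using assms(1) by (simp add: deriv_seq_def has_field_derivative_def)
  from has_derivative_compose[OF s this] show ?thesis .
qed

lemma sum_axis: "(\<Sum>j\<in>UNIV. a j * axis i (1::real) $ j) = a i"
  by (simp add: axis_def if_distrib cong: if_cong)

text \<open>The factor x_i^(p-1) / r^p is kept as a product of three simple functions, ready for the
  product rule and for membership in a function algebra.\<close>

lemma partial_deriv_radial: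
  assumes "deriv_seq F" "\<And>y. y \<in> \<Omega> \<Longrightarrow> u y = F n (ln (rad p y))" "x \<in> \<Omega>"
  shows "partial_deriv i u x =
    F (Suc n) (ln (rad p x)) * (real_power (x $ i) p * inverse (x $ i) * inverse (power_sum p x))"
  using partial_deriv_eq_on_open[OF open_dom assms(3,2) has_derivative_radial[OF assms(1,3)]]
  by (simp add: sum_axis divide_inverse)

lemma smooth_on_radial:
  assumes F: "deriv_seq F" and u: "\<And>y. y \<in> \<Omega> \<Longrightarrow> u y = F 0 (ln (rad p y))"
  shows "smooth_on \<Omega> u"
proof (rule function_algebra_smooth_on[OF open_dom])
  \<comment> \<open>These families are closed under differentiation up to sums and products: all
    derivatives \<open>F n\<close> are included, and the other generators produce each other's
    derivatives.\<close>
  define G where "G = range (\<lambda>i x. real_power (x $ i) p) \<union> range (\<lambda>i (x :: real ^ 'n). inverse (x $ i))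
    \<union> {\<lambda>x. inverse (power_sum p x)} \<union> range (\<lambda>n (x :: real ^ 'n). F n (ln (rad p x)))"
  have mem: "(\<lambda>x. real_power (x $ i) p) \<in> function_algebra \<Omega> G"
    "(\<lambda>x. inverse (x $ i)) \<in> function_algebra \<Omega> G"
    "(\<lambda>x. inverse (power_sum p x)) \<in> function_algebra \<Omega> G"
    "(\<lambda>x. F n (ln (rad p x))) \<in> function_algebra \<Omega> G" for i n
    by (auto simp: G_def intro!: function_algebra.gen)
  note [intro!] = mem function_algebra.mult function_algebra.const
  show "u \<in> function_algebra \<Omega> G"
    using u by (rule function_algebra.cong[OF mem(4)])
  fix g assume "g \<in> G"
  then consider i where "g = (\<lambda>x. real_power (x $ i) p)" | i where "g = (\<lambda>x. inverse (x $ i))"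
    | "g = (\<lambda>x. inverse (power_sum p x))" | n where "g = (\<lambda>x. F n (ln (rad p x)))"
    unfolding G_def by auto
  then have "g differentiable_on \<Omega> \<and> (\<forall>j. partial_deriv j g \<in> function_algebra \<Omega> G)"
  proof cases
    case (1 i)
    have "partial_deriv j g \<in> function_algebra \<Omega> G" for j
      by (rule function_algebra.cong[of "\<lambda>x. p * axis j 1 $ i * (real_power (x $ i) p * inverse (x $ i))"])
        (auto simp: 1 partial_deriv_eq[OF has_derivative_coord_power] divide_inverse)
    moreover have "g differentiable_on \<Omega>"
      unfolding 1 by (rule has_derivative_imp_differentiable_on[OF has_derivative_coord_power])
    ultimately show ?thesis by blast
  next
    case (2 i)
    have "partial_deriv j g \<in> function_algebra \<Omega> G" for j
      by (rule function_algebra.cong[of "\<lambda>x. - axis j 1 $ i * (inverse (x $ i) * inverse (x $ i))"],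
          intro function_algebra.mult function_algebra.const mem)
        (auto simp: 2 partial_deriv_eq[OF has_derivative_inverse_coord] power2_eq_square)
    moreover have "g differentiable_on \<Omega>"
      unfolding 2 by (rule has_derivative_imp_differentiable_on[OF has_derivative_inverse_coord])
    ultimately show ?thesis by blast
  next
    case 3
    have "partial_deriv j g \<in> function_algebra \<Omega> G" for j
      by (rule function_algebra.cong[of "\<lambda>x. - p * (inverse (power_sum p x) * inverse (power_sum p x)
          * (real_power (x $ j) p * inverse (x $ j)))"],
          intro function_algebra.mult function_algebra.const mem)
        (auto simp: 3 partial_deriv_eq[OF has_derivative_inverse_power_sum] power2_eq_square
          sum_axis divide_inverse)
    moreover have "g differentiable_on \<Omega>"
      unfolding 3 by (rule has_derivative_imp_differentiable_on[OF has_derivative_inverse_power_sum])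
    ultimately show ?thesis by blast
  next
    case (4 n)
    have "partial_deriv j g \<in> function_algebra \<Omega> G" for j
      by (rule function_algebra.cong[of "\<lambda>x. F (Suc n) (ln (rad p x)) *
          (real_power (x $ j) p * inverse (x $ j) * inverse (power_sum p x))"])
        (auto simp: 4 partial_deriv_radial[OF F])
    moreover have "g differentiable_on \<Omega>"
      unfolding 4 by (rule has_derivative_imp_differentiable_on[OF has_derivative_radial[OF F]])
    ultimately show ?thesis by blast
  qed
  then show "g differentiable_on \<Omega>" "\<And>i. partial_deriv i g \<in> function_algebra \<Omega> G" by auto
qed

text \<open>Write T for x_i times the i-th partial derivative. Then x_i^2 times the second partial
  derivative is T^2 - T, and T F(ln r) = F'(ln r) w with T w = p w (1 - w).\<close>

lemma partial_deriv2_radial: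
  fixes i :: 'n
  assumes F: "deriv_seq F" and u: "\<And>y. y \<in> \<Omega> \<Longrightarrow> u y = F n (ln (rad p y))" and x: "x \<in> \<Omega>"
  defines "w \<equiv> real_power (x $ i) p / power_sum p x"
  shows "(x $ i)\<^sup>2 * partial_deriv i (partial_deriv i u) x =
    F (Suc (Suc n)) (ln (rad p x)) * w\<^sup>2 + F (Suc n) (ln (rad p x)) * (p * w * (1 - w) - w)"
proof -
  note d = has_derivative_mult[OF has_derivative_radial[OF F x]
      has_derivative_mult[OF has_derivative_mult[OF has_derivative_coord_power[OF x, of i]
        has_derivative_inverse_coord[OF x, of i]] has_derivative_inverse_power_sum[OF x]]]
  have "partial_deriv i (partial_deriv i u) x =
    F (Suc (Suc n)) (ln (rad p x)) *
      (real_power (x $ i) p * inverse (x $ i) * inverse (power_sum p x))\<^sup>2 +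
    F (Suc n) (ln (rad p x)) *
      (p * real_power (x $ i) p * (inverse (x $ i))\<^sup>2 * inverse (power_sum p x)
       - real_power (x $ i) p * (inverse (x $ i))\<^sup>2 * inverse (power_sum p x)
       - p * (real_power (x $ i) p * inverse (x $ i) * inverse (power_sum p x))\<^sup>2)"
    using partial_deriv_eq_on_open[OF open_dom x partial_deriv_radial[OF F u, where i = i] d, of i]
    by (simp only: sum_axis axis_nth) (simp add: divide_inverse power2_eq_square algebra_simps)
  \<comment> \<open>Stated for arbitrary reals, so that the powers and the sum r^p are atoms for the
    field arithmetic.\<close>
  moreover have "X\<^sup>2 * (a * (R * inverse X * inverse P)\<^sup>2 +
     b * (p * R * (inverse X)\<^sup>2 * inverse P - R * (inverse X)\<^sup>2 * inverse P
       - p * (R * inverse X * inverse P)\<^sup>2)) =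
     a * (R / P)\<^sup>2 + b * (p * (R / P) * (1 - R / P) - R / P)"
    if "X \<noteq> 0" "P \<noteq> 0" for X P R a b :: real
    using that by (simp add: field_simps power2_eq_square)
  ultimately show ?thesis
    using nonzero_dom[OF x, of i] power_sum_pos[OF x] by (simp add: w_def)
qed

text \<open>
  With \<open>w i = x\<^sub>i\<^sup>p / r\<^sup>p\<close> the weight \<open>(r / x\<^sub>i)\<^sup>p\<close> in the operator is \<open>1 / w i\<close>, and \<open>\<Sum>i. w i = 1\<close>.
\<close>

lemma L_op_radial:
  assumes F: "deriv_seq F" and u: "\<And>y. y \<in> \<Omega> \<Longrightarrow> u y = F 0 (ln (rad p y))" and x: "x \<in> \<Omega>"
    and \<phi>: "2 * \<phi> = - p + real CARD('n) * (p - 1) + (\<Sum>i\<in>UNIV. \<alpha> i)"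
  shows "L_op p \<alpha> c u x = shift_poly [:c, 2 * \<phi>, 1:] (\<lambda>n. F n (ln (rad p x))) 0"
proof -
  define w where "w i = real_power (x $ i) p / power_sum p x" for i
  define a where "a n = F n (ln (rad p x))" for n
  have P: "power_sum p x > 0" by (rule power_sum_pos[OF x])
  have w0: "w i \<noteq> 0" for i
    using P real_power_nonzero[OF nonzero_dom[OF x]] by (simp add: w_def)
  have w1: "(\<Sum>i\<in>UNIV. w i) = 1"
    using P by (simp add: w_def power_sum_def sum_divide_distrib[symmetric])
  have rp: "real_power (rad p x / x $ i) p = 1 / w i" for i
    using real_power_divide[OF rad_pos[OF dom x] nonzero_dom[OF x]] rad_power[OF dom x p]
    by (simp add: w_def power_sum_def)
  \<comment> \<open>Cancelling one factor \<open>w i\<close> leaves an expression affine in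
    \<open>w i\<close>, so the sum over i needs only that the weights add up to 1.\<close>
  have "real_power (rad p x / x $ i) p *
        ((x $ i)\<^sup>2 * partial_deriv i (partial_deriv i u) x + \<alpha> i * x $ i * partial_deriv i u x)
      = a 2 * w i + a 1 * (p - 1 - p * w i + \<alpha> i)" for i
  proof -
    have "x $ i * partial_deriv i u x = a 1 * w i"
      using partial_deriv_radial[OF F u x, where i = i] nonzero_dom[OF x, of i]
      by (simp add: a_def w_def divide_inverse)
    then have "\<alpha> i * x $ i * partial_deriv i u x = \<alpha> i * (a 1 * w i)" by simp
    moreover have "(x $ i)\<^sup>2 * partial_deriv i (partial_deriv i u) x =
        a 2 * (w i)\<^sup>2 + a 1 * (p * w i * (1 - w i) - w i)"
      using partial_deriv2_radial[OF F u x, where i = i] by (simp add: a_def w_def numeral_2_eq_2)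
    ultimately show ?thesis
      using w0[of i] by (simp only: rp) (simp add: field_simps power2_eq_square)
  qed
  then have "L_op p \<alpha> c u x = (\<Sum>i\<in>UNIV. a 2 * w i + a 1 * (p - 1 - p * w i + \<alpha> i)) + c * a 0"
    by (simp add: L_op_def a_def u[OF x])
  also have "(\<Sum>i\<in>UNIV. a 2 * w i + a 1 * (p - 1 - p * w i + \<alpha> i)) =
      a 2 * (\<Sum>i\<in>UNIV. w i) +
      a 1 * (real CARD('n) * (p - 1) - p * (\<Sum>i\<in>UNIV. w i) + (\<Sum>i\<in>UNIV. \<alpha> i))"
    by (simp add: sum.distrib sum_subtractf sum_distrib_left sum_distrib_right algebra_simps)
  \<comment> \<open>The first-order coefficient n (p - 1) - p plus the sum of the \<alpha> i is
    exactly 2 \<phi>.\<close>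
  also have "\<dots> = a 2 + a 1 * (2 * \<phi>)"
    unfolding w1 \<phi> by (simp add: algebra_simps)
  finally show ?thesis by (simp add: a_def numeral_2_eq_2)
qed

text \<open>Every L_j maps a radial function to a radial one whose derivative sequence is the old
  one under the quadratic polynomial of L_j. The quadratics accumulate as a product, the tail of the
  list acting first.\<close>

lemma iterated_L_op_radial:
  fixes \<alpha> :: "nat \<Rightarrow> 'n \<Rightarrow> real"
  assumes \<phi>: "\<And>j. j \<in> set js \<Longrightarrow>
      2 * \<phi> j = - p + real CARD('n) * (p - 1) + (\<Sum>i\<in>UNIV. \<alpha> j i)"
    and F: "deriv_seq F" and u: "\<And>y. y \<in> \<Omega> \<Longrightarrow> u y = F 0 (ln (rad p y))" and "x \<in> \<Omega>"
  shows "foldr (\<circ>) (map (\<lambda>j. L_op p (\<alpha> j) (c j) ^^ k j) js) id u x =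
    shift_poly (prod_list (map (\<lambda>j. [:c j, 2 * \<phi> j, 1:] ^ k j) js)) (\<lambda>n. F n (ln (rad p x))) 0"
  using \<phi> \<open>x \<in> \<Omega>\<close>
proof (induction js arbitrary: x)
  case Nil
  then show ?case using u by (simp add: one_pCons)
next
  case (Cons j js)
  let ?R = "prod_list (map (\<lambda>j. [:c j, 2 * \<phi> j, 1:] ^ k j) js)"
  let ?v = "foldr (\<circ>) (map (\<lambda>j. L_op p (\<alpha> j) (c j) ^^ k j) js) id u"
  \<comment> \<open>The identity is carried for all points of \<Omega>, since the next application
    differentiates and needs it on an open set.\<close>
  have "(L_op p (\<alpha> j) (c j) ^^ m) ?v x =
      shift_poly ([:c j, 2 * \<phi> j, 1:] ^ m * ?R) (\<lambda>n. F n (ln (rad p x))) 0" if "x \<in> \<Omega>" for m x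
    using that
  proof (induction m arbitrary: x)
    case 0
    then show ?case using Cons by simp
  next
    case (Suc m)
    have "2 * \<phi> j = - p + real CARD('n) * (p - 1) + (\<Sum>i\<in>UNIV. \<alpha> j i)"
      using Cons.prems by simp
    from L_op_radial[OF deriv_seq_shift_poly[OF F] Suc.IH Suc.prems this, of "c j"]
    show ?case by (simp add: shift_poly_mult del: shift_poly_pCons mult_pCons_left)
  qed
  from this[OF Cons.prems(2), of "k j"] show ?case
    unfolding list.map foldr_Cons prod_list.Cons by (subst comp_apply, subst comp_apply)
qed

end

section \<open>Assembling the explicit radial solutions\<close>

theorem theorem1:
  fixes q :: nat and k :: "nat \<Rightarrow> nat"
    and \<alpha> :: "nat \<Rightarrow> 'n::finite \<Rightarrow> real"
    and lam \<phi> :: "nat \<Rightarrow> real" and p :: real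
    and I\<^sub>1 I\<^sub>2 I\<^sub>3 :: "nat set"
    and A B C D E :: "nat \<Rightarrow> nat \<Rightarrow> real"
    and \<Omega> :: "(real ^ 'n) set"
    and u :: "real ^ 'n \<Rightarrow> real"
  assumes "0 < q" and "\<And>j. j \<in> {1..q} \<Longrightarrow> 0 < k j" and "0 < p"
    and "regularity_domain p \<Omega>"
    and "\<And>j. j \<in> {1..q} \<Longrightarrow>
           2 * \<phi> j = - p + real CARD('n) * (p - 1) + (\<Sum>i\<in>UNIV. \<alpha> j i)"
    and "I\<^sub>1 = {v \<in> {1..q}. (\<phi> v)\<^sup>2 - lam v > 0}"
    and "I\<^sub>2 = {v \<in> {1..q}. (\<phi> v)\<^sup>2 - lam v < 0}"
    and "I\<^sub>3 = {v \<in> {1..q}. (\<phi> v)\<^sup>2 - lam v = 0}"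
    and "\<And>x. x \<in> \<Omega> \<Longrightarrow> u x =
      (\<Sum>v\<in>I\<^sub>1. \<Sum>l<k v. rad p x powr (- \<phi> v) *
         (A v l * rad p x powr sqrt ((\<phi> v)\<^sup>2 - lam v)
          + B v l * rad p x powr (- sqrt ((\<phi> v)\<^sup>2 - lam v))) * ln (rad p x) ^ l)
      + (\<Sum>v\<in>I\<^sub>2. \<Sum>l<k v. rad p x powr (- \<phi> v) *
         (C v l * cos (sqrt (lam v - (\<phi> v)\<^sup>2) * ln (rad p x))
          + D v l * sin (sqrt (lam v - (\<phi> v)\<^sup>2) * ln (rad p x))) * ln (rad p x) ^ l)
      + (\<Sum>v\<in>I\<^sub>3. \<Sum>l<2 * k v. E v l * rad p x powr (- \<phi> v) * ln (rad p x) ^ l)"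
  shows "smooth_on \<Omega> u \<and>
    (\<forall>x\<in>\<Omega>. iterated_product q (\<lambda>j. L_op p (\<alpha> j) (lam j)) k u x = 0)"
proof -
  have dom: "0 < rad p x" if "x \<in> \<Omega>" for x using rad_pos assms(4) that by blast
  \<comment> \<open>The characteristic polynomial of the j-th operator in the variable s = ln
    r.\<close>
  define Q where "Q j = [:lam j, 2 * \<phi> j, 1:]" for j
  define R where "R = prod_list (map (\<lambda>j. Q j ^ k j) [1..<Suc q])"
  have dvd: "Q v ^ k v dvd R" if "v \<in> {1..q}" for v
    unfolding R_def using that by (intro prod_list_dvd) (auto simp del: upt_Suc)
  have root: "poly (map_poly of_real (Q v)) z = z\<^sup>2 + of_real (2 * \<phi> v) * z + of_real (lam v)"
    for v and z :: complex
    by (simp add: Q_def map_poly_pCons algebra_simps power2_eq_square)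
  have sol: "solves_ode R (\<lambda>s. s ^ l * Re (c * exp (z * of_real s)))"
    if "v \<in> {1..q}" "poly (map_poly of_real (Q v)) z = 0" "l < k v" for v l c z
    using solves_ode_dvd[OF solves_ode_Re_exp[OF that(2,3)] dvd[OF that(1)]] .
  have Re_exp_real: "Re (of_real a * exp (of_real b * of_real s)) = a * exp (b * s)" for a b s
    by (simp add: Re_exp)
  have 1: "solves_ode R (\<lambda>s. exp (- \<phi> v * s) *
         (A v l * exp (sqrt ((\<phi> v)\<^sup>2 - lam v) * s)
          + B v l * exp (- sqrt ((\<phi> v)\<^sup>2 - lam v) * s)) * s ^ l)"
    if "v \<in> I\<^sub>1" "l < k v" for v l
  proof -
    let ?\<mu> = "sqrt ((\<phi> v)\<^sup>2 - lam v)"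
    have v: "v \<in> {1..q}" and \<mu>: "?\<mu>\<^sup>2 = (\<phi> v)\<^sup>2 - lam v" using that assms(6) by auto
    \<comment> \<open>The values 1 and -1 of \<epsilon> give the two real roots.\<close>
    have "poly (map_poly of_real (Q v)) (of_real (- \<phi> v + \<epsilon> * ?\<mu>)) = (0 :: complex)"
      if "\<epsilon>\<^sup>2 = 1" for \<epsilon>
    proof -
      have "(- \<phi> v + \<epsilon> * ?\<mu>)\<^sup>2 + 2 * \<phi> v * (- \<phi> v + \<epsilon> * ?\<mu>) + lam v = \<epsilon>\<^sup>2 * ?\<mu>\<^sup>2 - (\<phi> v)\<^sup>2 + lam v"
        by (simp only: power2_eq_square) (simp only: algebra_simps)
      also have "\<dots> = 0" using \<mu> that by simp
      finally show ?thesis unfolding root by (metis of_real_0 of_real_add of_real_mult of_real_power)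
    qed
    note s = solves_ode_add[OF sol[OF v this[of 1] that(2), of "of_real (A v l)"]
        sol[OF v this[of "-1"] that(2), of "of_real (B v l)"]]
    show ?thesis
      using s unfolding Re_exp_real by (simp add: divide_inverse exp_add exp_diff exp_minus algebra_simps)
  qed
  have 2: "solves_ode R (\<lambda>s. exp (- \<phi> v * s) *
         (C v l * cos (sqrt (lam v - (\<phi> v)\<^sup>2) * s)
          + D v l * sin (sqrt (lam v - (\<phi> v)\<^sup>2) * s)) * s ^ l)"
    if "v \<in> I\<^sub>2" "l < k v" for v l
  proof -
    let ?\<omega> = "sqrt (lam v - (\<phi> v)\<^sup>2)"
    \<comment> \<open>The absolute value is what the product of the square root with itself
      simplifies to.\<close>
    have v: "v \<in> {1..q}" and \<omega>: "\<bar>lam v - \<phi> v * \<phi> v\<bar> = lam v - \<phi> v * \<phi> v"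
      using that assms(7) by (auto simp: power2_eq_square)
    have "poly (map_poly of_real (Q v)) (Complex (- \<phi> v) ?\<omega>) = 0"
      unfolding root by (simp add: complex_eq_iff power2_eq_square \<omega>)
    \<comment> \<open>The real part of (C - i D) (cos t + i sin t) is C cos t + D sin t.\<close>
    from sol[OF v this that(2), of "Complex (C v l) (- D v l)"]
    show ?thesis by (simp add: Re_exp Im_exp algebra_simps)
  qed
  have 3: "solves_ode R (\<lambda>s. E v l * exp (- \<phi> v * s) * s ^ l)"
    if "v \<in> I\<^sub>3" "l < 2 * k v" for v l
  proof -
    have v: "v \<in> {1..q}" and \<phi>: "lam v = \<phi> v * \<phi> v"
      using that assms(8) by (auto simp: power2_eq_square)
    \<comment> \<open>At a double root the quadratic is the square of X + \<phi>, so R contains 2 k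
      linear factors and powers of s up to 2 k - 1 are allowed.\<close>
    have "[:\<phi> v, 1:] ^ 2 = Q v" by (simp add: Q_def power2_eq_square \<phi>)
    then have "[:\<phi> v, 1:] ^ (2 * k v) dvd R" using dvd[OF v] by (simp add: power_mult)
    moreover have "poly (map_poly of_real [:\<phi> v, 1:]) (of_real (- \<phi> v)) = (0 :: complex)"
      by (simp add: map_poly_pCons)
    ultimately have "solves_ode R (\<lambda>s. s ^ l * Re (of_real (E v l) * exp (of_real (- \<phi> v) * of_real s)))"
      using solves_ode_Re_exp[OF _ that(2)] solves_ode_dvd by blast
    then show ?thesis unfolding Re_exp_real by (simp add: mult_ac)
  qed
  define g where "g s =
      (\<Sum>v\<in>I\<^sub>1. \<Sum>l<k v. exp (- \<phi> v * s) *
         (A v l * exp (sqrt ((\<phi> v)\<^sup>2 - lam v) * s)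
          + B v l * exp (- sqrt ((\<phi> v)\<^sup>2 - lam v) * s)) * s ^ l)
      + (\<Sum>v\<in>I\<^sub>2. \<Sum>l<k v. exp (- \<phi> v * s) *
         (C v l * cos (sqrt (lam v - (\<phi> v)\<^sup>2) * s)
          + D v l * sin (sqrt (lam v - (\<phi> v)\<^sup>2) * s)) * s ^ l)
      + (\<Sum>v\<in>I\<^sub>3. \<Sum>l<2 * k v. E v l * exp (- \<phi> v * s) * s ^ l)" for s
  have "solves_ode R g"
    unfolding g_def[abs_def] by (intro solves_ode_add solves_ode_sum 1 2 3) auto
  then obtain F where F: "deriv_seq F" "F 0 = g" "\<And>s. shift_poly R (\<lambda>n. F n s) = (\<lambda>n. 0)"
    unfolding solves_ode_def by blast
  \<comment> \<open>For r > 0 a power r^a equals exp (a ln r), so u is g evaluated at ln r.\<close>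
  have u: "u x = F 0 (ln (rad p x))" if "x \<in> \<Omega>" for x
    unfolding assms(9)[OF that] F(2) g_def using dom[OF that] by (simp add: powr_def)
  have "iterated_product q (\<lambda>j. L_op p (\<alpha> j) (lam j)) k u x = 0" if "x \<in> \<Omega>" for x
  proof -
    have "iterated_product q (\<lambda>j. L_op p (\<alpha> j) (lam j)) k u x = shift_poly R (\<lambda>n. F n (ln (rad p x))) 0"
      unfolding iterated_product_def R_def Q_def
      by (rule iterated_L_op_radial[OF assms(3,4) _ F(1) u that])
        (use assms(5) in \<open>auto simp del: upt_Suc\<close>)
    then show ?thesis by (simp add: F(3))
  qed
  then show ?thesis using smooth_on_radial[OF assms(3,4) F(1) u] by blast
qed

end
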